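(* Let $A$ be a Banach algebra with identity, let $B$ be a semisimple Banach algebra, and let $\theta,\phi$ be nonzero multiplicative linear functionals on $B$. If $\theta\neq\phi$, then $$\mathrm{Der}_J(A\times_\theta^{\phi,\phi}B)=\mathrm{Der}(A\times_\theta^{\phi,\phi}B),$$ and this set is identified with $\mathrm{Der}(B)$, in the sense that $d\mapsto d_B$, where $d_B(b)=\pi_B(d(0,b))$ for $b\in B$, is a bijection from it onto $\mathrm{Der}(B)$.
   Context: Banach algebras are over $\mathbb{C}$. A derivation on an algebra $C$ is a linear map $D:C\to C$ (no continuity assumed) with $D(cx)=D(c)x+cD(x)$ for all $c,x\in C$; the set of these is $\mathrm{Der}(C)$. For a multiplicative linear functional $\eta$ on $B$, the $\eta$-Lau product on the vector space $A\times B$ is $$(a,b)\cdot_\eta(x,y)=(ax+\eta(y)a+\eta(b)x,\ by).$$ For nonzero multiplicative linear functionals $\theta,\phi,\gamma$ on $B$, $\mathrm{Der}_J(A\times_\theta^{\phi,\gamma}B)$ denotes the set of all linear maps $d:A\times B\to A\times B$ satisfying $$d((a,b)\cdot_\theta(a,b))=d(a,b)\cdot_\phi(a,b)+(a,b)\cdot_\gamma d(a,b)\qquad(a\in A,\ b\in B),$$ and $\mathrm{Der}(A\times_\theta^{\phi,\gamma}B)$ denotes the set of all linear maps $d:A\times B\to A\times B$ satisfying $$d((a,b)\cdot_\theta(x,y))=d(a,b)\cdot_\phi(x,y)+(a,b)\cdot_\gamma d(x,y)\qquad(a,x\in A,\ b,y\in B).$$ Here these are used with $\gamma=\phi$. $\pi_B:A\times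 B\to B$ is the canonical projection. *)

theory Defs
  imports "HOL-Analysis.Analysis"
begin

section \<open>Complex Banach algebras\<close>

text \<open>The library has real Banach algebras only. The classes below add a complex scalar
  multiplication extending the real one. Algebras need not have an identity; where one is
  required, the sort is combined with \<^class>\<open>monoid_mult\<close>, which neither excludes
  the zero algebra nor asks the identity to have norm one.\<close>

class complex_vector = real_vector +
  fixes scaleC :: "complex \<Rightarrow> 'a \<Rightarrow> 'a" (infixr \<open>*\<^sub>C\<close> 75)
  assumes scaleC_add_right: "c *\<^sub>C (x + y) = c *\<^sub>C x + c *\<^sub>C y"
    and scaleC_add_left: "(c + c') *\<^sub>C x = c *\<^sub>C x + c' *\<^sub>C x"
    and scaleC_scaleC: "c *\<^sub>C c' *\<^sub>C x = (c * c') *\<^sub>C x"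
    and scaleC_of_real: "complex_of_real r *\<^sub>C x = r *\<^sub>R x"

class complex_banach_algebra = complex_vector + real_normed_algebra + banach +
  assumes mult_scaleC_left: "(c *\<^sub>C x) * y = c *\<^sub>C (x * y)"
    and mult_scaleC_right: "x * (c *\<^sub>C y) = c *\<^sub>C (x * y)"
    and norm_scaleC: "norm (c *\<^sub>C x) = cmod c * norm x"

lemma scaleC_one: "1 *\<^sub>C x = (x :: 'a::complex_vector)"
  using scaleC_of_real[of 1 x] by simp

lemma vector_space_scaleC:
  "vector_space (scaleC :: complex \<Rightarrow> 'a \<Rightarrow> 'a::complex_vector)"
  by unfold_locales (simp_all add: scaleC_add_right scaleC_add_left scaleC_scaleC scaleC_one)

instantiation complex :: complex_banach_algebra
begin

definition scaleC_complex :: "complex \<Rightarrow> complex \<Rightarrow> complex"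
  where "scaleC_complex c x = c * x"

instance
  by intro_classes
    (simp_all add: scaleC_complex_def algebra_simps scaleR_conv_of_real norm_mult)

end

instantiation prod :: (complex_vector, complex_vector) complex_vector
begin

definition scaleC_prod :: "complex \<Rightarrow> 'a \<times> 'b \<Rightarrow> 'a \<times> 'b"
  where "scaleC_prod c p = (c *\<^sub>C fst p, c *\<^sub>C snd p)"

instance
  by intro_classes
    (simp_all add: scaleC_prod_def prod_eq_iff scaleC_add_right scaleC_add_left
      scaleC_scaleC scaleC_of_real)

end

abbreviation clinear :: "('a::complex_vector \<Rightarrow> 'b::complex_vector) \<Rightarrow> bool"
  where "clinear \<equiv> Vector_Spaces.linear scaleC scaleC"

abbreviation csubspace :: "'a::complex_vector set \<Rightarrow> bool"
  where "csubspace \<equiv> module.subspace scaleC"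


section \<open>Semisimplicity\<close>

definition left_ideal :: "'a::complex_banach_algebra set \<Rightarrow> bool"
  where "left_ideal L \<longleftrightarrow> csubspace L \<and> (\<forall>a. \<forall>x\<in>L. a * x \<in> L)"

text \<open>The element \<open>u\<close> is a right identity modulo \<open>L\<close>.\<close>

definition modular_left_ideal :: "'a::complex_banach_algebra set \<Rightarrow> bool"
  where "modular_left_ideal L \<longleftrightarrow> left_ideal L \<and> (\<exists>u. \<forall>x. x - x * u \<in> L)"

definition maximal_left_ideal :: "'a::complex_banach_algebra set \<Rightarrow> bool"
  where "maximal_left_ideal L \<longleftrightarrow>
    left_ideal L \<and> L \<noteq> UNIV \<and> (\<forall>J. left_ideal J \<and> L \<subseteq> J \<longrightarrow> J = L \<or> J = UNIV)"

text \<open>No closedness is imposed on the ideals. Without maximal modular left ideals, the radical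
  is the whole algebra.\<close>

definition jacobson_radical :: "'a::complex_banach_algebra set"
  where "jacobson_radical = \<Inter>{L. modular_left_ideal L \<and> maximal_left_ideal L}"

definition semisimple :: "'a::complex_banach_algebra itself \<Rightarrow> bool"
  where "semisimple _ \<longleftrightarrow> jacobson_radical = {0 :: 'a}"


section \<open>Multiplicative functionals and derivations\<close>

definition multiplicative_functional :: "('a::complex_banach_algebra \<Rightarrow> complex) \<Rightarrow> bool"
  where "multiplicative_functional \<eta> \<longleftrightarrow> clinear \<eta> \<and> (\<forall>x y. \<eta> (x * y) = \<eta> x * \<eta> y)"

definition Der :: "('a::complex_banach_algebra \<Rightarrow> 'a) set"
  where "Der = {D. clinear D \<and> (\<forall>c x. D (c * x) = D c * x + c * D x)}"

fun lau_times ::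
    "('b \<Rightarrow> complex) \<Rightarrow> 'a::complex_banach_algebra \<times> 'b::complex_banach_algebra \<Rightarrow> 'a \<times> 'b \<Rightarrow> 'a \<times> 'b"
  where "lau_times \<eta> (a, b) (x, y) = (a * x + \<eta> y *\<^sub>C a + \<eta> b *\<^sub>C x, b * y)"

definition lau_Der ::
    "('b \<Rightarrow> complex) \<Rightarrow> ('b \<Rightarrow> complex) \<Rightarrow> ('b \<Rightarrow> complex) \<Rightarrow>
     ('a::complex_banach_algebra \<times> 'b::complex_banach_algebra \<Rightarrow> 'a \<times> 'b) set"
  where "lau_Der \<theta> \<phi> \<gamma> =
    {d. clinear d \<and>
      (\<forall>p q. d (lau_times \<theta> p q) = lau_times \<phi> (d p) q + lau_times \<gamma> p (d q))}"

definition lau_Der_J ::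
    "('b \<Rightarrow> complex) \<Rightarrow> ('b \<Rightarrow> complex) \<Rightarrow> ('b \<Rightarrow> complex) \<Rightarrow>
     ('a::complex_banach_algebra \<times> 'b::complex_banach_algebra \<Rightarrow> 'a \<times> 'b) set"
  where "lau_Der_J \<theta> \<phi> \<gamma> =
    {d. clinear d \<and>
      (\<forall>p. d (lau_times \<theta> p p) = lau_times \<phi> (d p) p + lau_times \<gamma> p (d p))}"

end

theory Submission
  imports Defs
begin

text \<open>Writing \<open>d (a, b) = (d\<^sub>1 a + d\<^sub>2 b, d\<^sub>3 a + d\<^sub>4 b)\<close>, the Jordan identity on squares of
  \<open>A\<close> forces \<open>d\<^sub>3 = 0\<close> and \<open>d\<^sub>1 1 = 0\<close>; the mixed terms with \<open>a = 1\<close> give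
  \<open>d\<^sub>2 b = - \<phi> (d\<^sub>4 b) 1\<close>, and then for general \<open>a\<close> they reduce to \<open>(\<theta> b - \<phi> b) d\<^sub>1 a = 0\<close>, so
  \<open>d\<^sub>1 = 0\<close>. Hence \<open>d\<close> is determined by the Jordan derivation \<open>d\<^sub>4\<close> of \<open>B\<close>. A semisimple algebra is
  semiprime, and by Bre\v{s}ar's theorem a Jordan derivation of a 2-torsion-free semiprime ring
  is a derivation.\<close>

section \<open>Jordan derivations of 2-torsion-free semiprime rings\<close>

locale semiprime_jordan_derivation =
  fixes d :: "'a::ring \<Rightarrow> 'a"
  assumes add: "d (x + y) = d x + d y"
    and square: "d (x * x) = d x * x + x * d x"
    and two_torsion_free: "(x::'a) + x = 0 \<Longrightarrow> x = 0"
    and semiprime: "(\<And>z. (a::'a) * z * a = 0) \<Longrightarrow> a = 0"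
begin

lemma minus: "d (- x) = - d x"
proof -
  have "d (0 + 0) = d 0 + d 0" by (rule add)
  then have "d 0 = 0" by simp
  then show ?thesis using add[of x "- x"] by (simp add: add_eq_0_iff)
qed

lemma diff: "d (x - y) = d x - d y"
  using add[of x "- y"] by (simp add: minus)

lemma double_cancel: "(x::'a) = y" if "x + x = y + y"
proof -
  have "(x - y) + (x - y) = 0" using that by (simp add: algebra_simps)
  then have "x - y = 0" by (rule two_torsion_free)
  then show ?thesis by simp
qed

lemma jordan_product: "d (x * y + y * x) = d x * y + x * d y + d y * x + y * d x"
  using square[of "x + y"] square[of x] square[of y] by (simp add: add algebra_simps)

text \<open>Twice \<open>x * y * x\<close> is a combination of Jordan products: take that of
  \<open>x\<close> with \<open>x * y + y * x\<close> and subtract that of \<open>x * x\<close> with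
  \<open>y\<close>.\<close>

lemma jordan_triple: "d (x * y * x) = d x * y * x + x * d y * x + x * y * d x"
proof (rule double_cancel)
  have "d (x * (x * y + y * x) + (x * y + y * x) * x)
      = d (x * x * y + y * (x * x)) + (d (x * y * x) + d (x * y * x))"
    unfolding add[symmetric] by (simp add: algebra_simps)
  then have "d (x * y * x) + d (x * y * x)
      = d (x * (x * y + y * x) + (x * y + y * x) * x) - d (x * x * y + y * (x * x))"
    by simp
  then show "d (x * y * x) + d (x * y * x)
      = d x * y * x + x * d y * x + x * y * d x + (d x * y * x + x * d y * x + x * y * d x)"
    unfolding jordan_product[of "x * x"] jordan_product[of x "x * y + y * x"]
      jordan_product[of x y] square
    by (simp add: algebra_simps)
qed

lemma jordan_triple_linearized:
  "d (x * y * z + z * y * x)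
    = d x * y * z + x * d y * z + x * y * d z + d z * y * x + z * d y * x + z * y * d x"
proof -
  have "d (x * y * z + z * y * x) = d ((x + z) * y * (x + z)) - d (x * y * x) - d (z * y * z)"
    unfolding diff[symmetric] by (simp add: algebra_simps)
  then show ?thesis
    unfolding jordan_triple by (simp add: add algebra_simps)
qed

definition defect :: "'a \<Rightarrow> 'a \<Rightarrow> 'a"
  where "defect x y = d (x * y) - d x * y - x * d y"

definition comm :: "'a \<Rightarrow> 'a \<Rightarrow> 'a"
  where "comm x y = x * y - y * x"

text \<open>\<open>jordan_product\<close> says precisely that the symmetric part of the biadditive
  \<open>defect\<close> vanishes.\<close>

lemma defect_swap: "defect y x = - defect x y"
  using jordan_product[of x y] by (simp add: defect_def add algebra_simps eq_neg_iff_add_eq_0)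

lemma defect_add: "defect (x + u) y = defect x y + defect u y"
  "defect x (y + v) = defect x y + defect x v"
  by (simp_all add: defect_def add algebra_simps)

lemma comm_add: "comm (x + u) y = comm x y + comm u y"
  "comm x (y + v) = comm x y + comm x v"
  by (simp_all add: comm_def algebra_simps)

text \<open>Both groupings of \<open>x y z y x + y x z x y\<close> are expanded and compared.\<close>

lemma defect_comm_anticommute: "defect x y * z * comm x y + comm x y * z * defect x y = 0"
proof -
  have "d (x * (y * z * y) * x) + d (y * (x * z * x) * y)
      = d ((x * y) * z * (y * x) + (y * x) * z * (x * y))"
    unfolding add[symmetric] by (simp add: algebra_simps)
  then have "defect x y * z * (y * x) + x * y * z * defect y x
      + defect y x * z * (x * y) + y * x * z * defect x y = 0"
    unfolding jordan_triple_linearized jordan_triple defect_def by (simp add: algebra_simps)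
  then show ?thesis
    unfolding defect_swap[of y x] comm_def by (simp add: algebra_simps)
qed

text \<open>The hypothesis exchanges \<open>a\<close> and \<open>b\<close> around any middle factor
  at the cost of a sign. An odd and an even number of exchanges both turn
  \<open>a * z * b * r * (a * z * b)\<close> into the same product up to sign, so it equals its own
  negative.\<close>

lemma sandwich_zero:
  assumes "\<And>z. a * z * b + b * z * a = (0::'a)"
  shows "a * z * b = 0"
proof (rule semiprime)
  have swap: "b * z * a = - (a * z * b)" for z
    using assms[of z] by (simp add: add_eq_0_iff)
  fix r
  have "a * z * b * r * (a * z * b) = a * z * (b * r * a) * z * b"
    by (simp add: mult.assoc)
  also have "\<dots> = - (a * z * a * r * b * z * b)"
    unfolding swap by (simp add: mult.assoc)
  finally have 1: "a * z * b * r * (a * z * b) = - (a * z * a * r * b * z * b)" .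
  have "a * z * b = - (b * z * a)" by (simp add: swap)
  then have "a * z * b * r * (a * z * b) = - (b * (z * a * r) * a * z * b)"
    by (simp add: mult.assoc)
  also have "\<dots> = a * z * a * r * b * z * b"
    unfolding swap by (simp add: mult.assoc)
  finally show "a * z * b * r * (a * z * b) = 0"
    using 1 two_torsion_free by (metis add.right_inverse)
qed

lemma defect_comm_same: "defect x y * z * comm x y = 0"
  by (rule sandwich_zero) (rule defect_comm_anticommute)

text \<open>Linearizing \<open>defect_comm_same\<close> in \<open>x\<close> exchanges
  \<open>x\<close> and \<open>u\<close> up to sign. Exchanged in the second factor of
  \<open>w * r * w\<close>, they leave a product that starts with \<open>defect x y\<close> and ends
  with \<open>comm x y\<close>.\<close>

lemma defect_comm_left: "defect x y * z * comm u y = 0"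
proof (rule semiprime)
  fix r
  have swap: "defect x y * z * comm u y = - (defect u y * z * comm x y)"
    using defect_comm_same[of "x + u" y z] defect_comm_same[of x y z] defect_comm_same[of u y z]
    by (simp add: defect_add comm_add algebra_simps eq_neg_iff_add_eq_0)
  have "defect x y * z * comm u y * r * (defect x y * z * comm u y)
      = defect x y * z * comm u y * r * - (defect u y * z * comm x y)"
    by (simp only: swap[symmetric])
  also have "\<dots> = - (defect x y * (z * comm u y * r * defect u y * z) * comm x y)"
    by (simp add: mult.assoc)
  finally show "defect x y * z * comm u y * r * (defect x y * z * comm u y) = 0"
    by (simp add: defect_comm_same)
qed

text \<open>The same argument, now linearizing \<open>defect_comm_left\<close> in
  \<open>y\<close>.\<close>

lemma defect_comm: "defect x y * z * comm u v = 0"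
proof (rule semiprime)
  fix r
  have swap: "defect x y * z * comm u v = - (defect x v * z * comm u y)"
    using defect_comm_left[of x "y + v" z u] defect_comm_left[of x y z u]
      defect_comm_left[of x v z u]
    by (simp add: defect_add comm_add algebra_simps eq_neg_iff_add_eq_0)
  have "defect x y * z * comm u v * r * (defect x y * z * comm u v)
      = defect x y * z * comm u v * r * - (defect x v * z * comm u y)"
    by (simp only: swap[symmetric])
  also have "\<dots> = - (defect x y * (z * comm u v * r * defect x v * z) * comm u y)"
    by (simp add: mult.assoc)
  finally show "defect x y * z * comm u v * r * (defect x y * z * comm u v) = 0"
    by (simp add: defect_comm_left)
qed

text \<open>The defect itself may be an entry of the commutator in \<open>defect_comm\<close>:
  expanding one of two factors \<open>comm ?a v\<close> puts \<open>?a\<close> in front of the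
  other.\<close>

lemma defect_central: "defect x y * v = v * defect x y"
proof -
  let ?a = "defect x y"
  have "comm ?a v = 0"
  proof (rule semiprime)
    fix z
    have "comm ?a v * z * comm ?a v = ?a * (v * z) * comm ?a v - v * (?a * z * comm ?a v)"
      unfolding comm_def[of ?a v] by (simp add: algebra_simps)
    then show "comm ?a v * z * comm ?a v = 0" by (simp add: defect_comm)
  qed
  then show ?thesis by (simp add: comm_def)
qed

text \<open>The ring may lack an identity, so the middle factor of \<open>defect_comm\<close> cannot
  be set to 1; semiprimeness removes it instead.\<close>

lemma defect_mult_comm: "defect x y * comm u v = 0"
proof (rule semiprime)
  fix r
  have "defect x y * comm u v * r * (defect x y * comm u v)
      = defect x y * (comm u v * r * defect x y) * comm u v"
    by (simp add: mult.assoc)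
  then show "defect x y * comm u v * r * (defect x y * comm u v) = 0"
    by (simp add: defect_comm)
qed

text \<open>The defect is a central element with vanishing cube: it annihilates all commutators, so
  \<open>2 a\<^sup>2 = a d [x, y]\<close> for \<open>a = defect x y\<close>, and applying \<open>d\<close> to \<open>a [x, y] + [x, y] a = 0\<close>
  shows \<open>2 a\<^sup>2 d [x, y] = 0\<close>.\<close>

lemma defect_zero: "defect x y = 0"
proof -
  define a where "a = defect x y"
  define c where "c = comm x y"
  have central: "a * v = v * a" for v
    unfolding a_def by (rule defect_central)
  have ann: "a * comm u v = 0" "a * z * comm u v = 0" for u v z
    unfolding a_def by (rule defect_mult_comm defect_comm)+
  have "a + a = defect x y - defect y x"
    by (simp add: defect_swap[of x y] a_def)
  also have "\<dots> = d c - comm (d x) y - comm x (d y)"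
    by (simp add: defect_def c_def comm_def diff algebra_simps)
  finally have "a * (a + a) = a * (d c - comm (d x) y - comm x (d y))"
    by simp
  then have sq: "a * a + a * a = a * d c"
    by (simp add: right_diff_distrib distrib_left ann)
  have ac: "a * c = 0" "c * a = 0"
    using ann(1)[of x y] central[of c] by (simp_all add: c_def)
  have "d 0 = 0" using diff[of 0 0] by simp
  then have "d a * c + a * d c + d c * a + c * d a = 0"
    using jordan_product[of a c] by (simp add: ac)
  \<comment> \<open>The extra factor \<open>a\<close> kills both terms containing
    \<open>d a\<close>; centrality makes the other two equal.\<close>
  then have "a * (d a * c + a * d c + d c * a + c * d a) = 0"
    by simp
  moreover have "a * (d a * c) = 0"
    using ann(2)[of "d a" x y] by (simp add: c_def mult.assoc)
  moreover have "a * (c * d a) = 0"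
    using ac by (simp flip: mult.assoc)
  ultimately have "a * (a * d c) + a * (a * d c) = 0"
    by (simp add: distrib_left central[of "d c", symmetric])
  then have "a * (a * d c) = 0" by (rule two_torsion_free)
  then have "a * (a * a) + a * (a * a) = 0"
    unfolding sq[symmetric] by (simp add: distrib_left)
  then have cube: "a * (a * a) = 0" by (rule two_torsion_free)
  \<comment> \<open>Centrality moves \<open>z\<close> out of the sandwich, so semiprimeness reduces
    the nilpotency: \<open>a * a\<close> vanishes because its square does, and then \<open>a\<close>
    likewise.\<close>
  have "a * a = 0"
  proof (rule semiprime)
    fix z
    have "a * a * z * (a * a) = z * (a * a) * (a * a)"
      by (metis central mult.assoc)
    then show "a * a * z * (a * a) = 0"
      using cube by (simp add: mult.assoc)
  qed
  then have "a * z * a = 0" for z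
    by (metis central mult.assoc mult_zero_right)
  then show ?thesis
    unfolding a_def[symmetric] by (rule semiprime)
qed

theorem derivation: "d (x * y) = d x * y + x * d y"
  using defect_zero[of x y] by (simp add: defect_def algebra_simps)

end

section \<open>Complex-linear maps and subspaces\<close>

lemma module_scaleC: "module (scaleC :: complex \<Rightarrow> 'a \<Rightarrow> 'a::complex_vector)"
  by (rule module_iff_vector_space[THEN iffD2, OF vector_space_scaleC])

lemma clinear_iff:
  "clinear f \<longleftrightarrow> (\<forall>x y. f (x + y) = f x + f y) \<and> (\<forall>c x. f (c *\<^sub>C x) = c *\<^sub>C f x)"
  unfolding Vector_Spaces.linear_iff_module_hom module_hom_iff
  by (simp add: module_scaleC)

lemma clinearD:
  assumes "clinear f"
  shows "f (x + y) = f x + f y" "f (c *\<^sub>C x) = c *\<^sub>C f x"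
  using assms by (simp_all add: clinear_iff)

lemma scaleC_zero: "0 *\<^sub>C x = (0 :: 'a::complex_vector)" "c *\<^sub>C 0 = (0 :: 'a)"
  using scaleC_add_left[of 0 0 x] scaleC_add_right[of c 0 "0 :: 'a"] by simp_all

lemma csubspace_iff:
  "csubspace S \<longleftrightarrow> 0 \<in> S \<and> (\<forall>x\<in>S. \<forall>y\<in>S. x + y \<in> S) \<and> (\<forall>c. \<forall>x\<in>S. c *\<^sub>C x \<in> S)"
  by (rule module.subspace_def[OF module_scaleC])

section \<open>Semisimple algebras are semiprime\<close>

lemma left_ideal_plus:
  fixes L I :: "'a::complex_banach_algebra set"
  assumes "left_ideal L" "left_ideal I"
  shows "left_ideal {x + y | x y. x \<in> L \<and> y \<in> I}"
  unfolding left_ideal_def csubspace_iff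
proof (intro conjI ballI allI)
  let ?S = "{x + y | x y. x \<in> L \<and> y \<in> I}"
  note L = assms(1)[unfolded left_ideal_def csubspace_iff]
  note I = assms(2)[unfolded left_ideal_def csubspace_iff]
  have "(0::'a) = 0 + 0" by simp
  then show "0 \<in> ?S" using L I by blast
  fix p assume "p \<in> ?S"
  then obtain x y where p: "p = x + y" "x \<in> L" "y \<in> I" by blast
  show "c *\<^sub>C p \<in> ?S" for c
    unfolding p(1) scaleC_add_right using p L I by blast
  show "a * p \<in> ?S" for a
    unfolding p(1) distrib_left using p L I by blast
  fix q assume "q \<in> ?S"
  then obtain x' y' where q: "q = x' + y'" "x' \<in> L" "y' \<in> I" by blast
  have "p + q = (x + x') + (y + y')" using p q by simp
  then show "p + q \<in> ?S" using p q L I by blast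
qed

text \<open>For a maximal modular left ideal \<open>M\<close>, maximality leaves
  \<open>M + I = M\<close> or \<open>M + I = UNIV\<close>. The second case is excluded by
  decomposing the right identity \<open>u\<close> modulo \<open>M\<close>.\<close>

lemma square_zero_left_ideal_subset_radical:
  fixes I :: "'a::complex_banach_algebra set"
  assumes I: "left_ideal I" and sq: "\<And>x y. x \<in> I \<Longrightarrow> y \<in> I \<Longrightarrow> x * y = 0"
  shows "I \<subseteq> jacobson_radical"
  unfolding jacobson_radical_def
proof (rule Inter_greatest)
  fix M :: "'a set"
  assume "M \<in> {L. modular_left_ideal L \<and> maximal_left_ideal L}"
  then have M: "left_ideal M" "M \<noteq> UNIV"
    and max: "\<And>J. left_ideal J \<Longrightarrow> M \<subseteq> J \<Longrightarrow> J = M \<or> J = UNIV"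
    and mod: "\<exists>u. \<forall>x. x - x * u \<in> M"
    by (auto simp: modular_left_ideal_def maximal_left_ideal_def)
  obtain u where u: "x - x * u \<in> M" for x using mod by blast
  have M_zero: "0 \<in> M" and I_zero: "0 \<in> I"
    and M_add: "x \<in> M \<Longrightarrow> y \<in> M \<Longrightarrow> x + y \<in> M"
    and M_mult: "y \<in> M \<Longrightarrow> x * y \<in> M" for x y
    using M(1) I by (auto simp: left_ideal_def csubspace_iff)
  let ?S = "{x + y | x y. x \<in> M \<and> y \<in> I}"
  have MS: "M \<subseteq> ?S" and IS: "I \<subseteq> ?S"
    using M_zero I_zero by force+
  have "?S \<noteq> UNIV"
  proof
    assume "?S = UNIV"
    then obtain m i where mi: "u = m + i" "m \<in> M" "i \<in> I" by blast
    \<comment> \<open>As \<open>i * i = 0\<close>, the product \<open>i * u\<close> lies in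
      \<open>M\<close>, hence so do \<open>i\<close> and \<open>u\<close>. A left ideal containing
      its own right modular identity is everything.\<close>
    have "i * u = i * m" using sq[OF mi(3) mi(3)] by (simp add: mi(1) distrib_left)
    then have "i \<in> M" using M_add[OF u[of i] M_mult[OF mi(2), of i]] by simp
    then have "u \<in> M" using mi M_add by simp
    then have "x \<in> M" for x using M_add[OF u[of x] M_mult[of u x]] by simp
    then show False using M(2) by blast
  qed
  then show "I \<subseteq> M"
    using max[OF left_ideal_plus[OF M(1) I] MS] IS by blast
qed

text \<open>Two square-zero left ideals are used in turn, because without an identity
  \<open>a\<close> need not be a left multiple of itself: first all \<open>z * a\<close>, and once
  these vanish, the line spanned by \<open>a\<close>.\<close>

lemma semisimple_imp_semiprime:
  fixes a :: "'a::complex_banach_algebra"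
  assumes ss: "semisimple TYPE('a)" and aza: "\<And>z. a * z * a = 0"
  shows "a = 0"
proof -
  have rad: "I \<subseteq> {0}" if "left_ideal I" "\<And>x y. x \<in> I \<Longrightarrow> y \<in> I \<Longrightarrow> x * y = 0" for I :: "'a set"
    using square_zero_left_ideal_subset_radical[OF that] ss by (simp add: semisimple_def)
  have "range (\<lambda>z. z * a) \<subseteq> {0}"
  proof (rule rad)
    have "0 \<in> range (\<lambda>z. z * a)" by (rule range_eqI[of _ _ 0]) simp
    then show "left_ideal (range (\<lambda>z. z * a))"
      by (auto simp: left_ideal_def csubspace_iff
          simp flip: distrib_right mult_scaleC_left mult.assoc)
    have "z * a * (w * a) = z * (a * w * a)" for z w by (simp add: mult.assoc)
    then show "x * y = 0" if "x \<in> range (\<lambda>z. z * a)" "y \<in> range (\<lambda>z. z * a)" for x y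
      using that aza by auto
  qed
  then have za: "z * a = 0" for z by auto
  have "range (\<lambda>c. c *\<^sub>C a) \<subseteq> {0}"
  proof (rule rad)
    have "0 \<in> range (\<lambda>c. c *\<^sub>C a)"
      by (rule range_eqI[of _ _ 0]) (simp add: scaleC_zero)
    then show "left_ideal (range (\<lambda>c. c *\<^sub>C a))"
      by (auto simp: left_ideal_def csubspace_iff scaleC_scaleC mult_scaleC_right za scaleC_zero
          simp flip: scaleC_add_left)
    show "x * y = 0" if "x \<in> range (\<lambda>c. c *\<^sub>C a)" "y \<in> range (\<lambda>c. c *\<^sub>C a)" for x y
      using that by (auto simp: mult_scaleC_right za scaleC_zero)
  qed
  then have "1 *\<^sub>C a = 0" by blast
  then show ?thesis by (simp add: scaleC_one)
qed

lemma semisimple_jordan_derivation_in_Der: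
  fixes D :: "'a::complex_banach_algebra \<Rightarrow> 'a"
  assumes "semisimple TYPE('a)" and "clinear D"
    and "\<And>x. D (x * x) = D x * x + x * D x"
  shows "D \<in> Der"
proof -
  interpret semiprime_jordan_derivation D
  proof
    show "x = 0" if "x + x = 0" for x :: 'a
      using that by (simp flip: scaleR_2)
    show "a = 0" if "\<And>z. a * z * a = 0" for a :: 'a
      using semisimple_imp_semiprime[OF assms(1)] that by blast
  qed (simp_all add: assms clinearD[OF assms(2)])
  show ?thesis using assms(2) derivation by (simp add: Der_def)
qed

section \<open>Derivations between Lau products\<close>

lemma scaleC_minus_left: "(- c) *\<^sub>C x = - (c *\<^sub>C x :: 'a::complex_vector)"
  using scaleC_add_left[of "- c" c x] by (simp add: scaleC_zero eq_neg_iff_add_eq_0)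

lemma scaleC_minus_right: "c *\<^sub>C (- x) = - (c *\<^sub>C x :: 'a::complex_vector)"
  using scaleC_add_right[of c "- x" x] by (simp add: scaleC_zero eq_neg_iff_add_eq_0)

lemma scaleC_eq_0D:
  assumes "c *\<^sub>C x = (0 :: 'a::complex_vector)" "c \<noteq> 0"
  shows "x = 0"
proof -
  have "x = inverse c *\<^sub>C c *\<^sub>C x" using assms(2) by (simp add: scaleC_scaleC scaleC_one)
  then show ?thesis by (simp add: assms(1) scaleC_zero)
qed

lemma multiplicative_functionalD:
  assumes "multiplicative_functional \<eta>"
  shows "\<eta> (x + y) = \<eta> x + \<eta> y" "\<eta> (c *\<^sub>C x) = c * \<eta> x" "\<eta> (x * y) = \<eta> x * \<eta> y" "\<eta> 0 = 0"
proof -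
  have lin: "clinear \<eta>" using assms by (simp add: multiplicative_functional_def)
  show "\<eta> (x + y) = \<eta> x + \<eta> y" "\<eta> (c *\<^sub>C x) = c * \<eta> x"
    using clinearD[OF lin] by (simp_all add: scaleC_complex_def)
  show "\<eta> (x * y) = \<eta> x * \<eta> y"
    using assms by (simp add: multiplicative_functional_def)
  show "\<eta> 0 = 0"
    using clinearD(1)[OF lin, of 0 0] by simp
qed

text \<open>The inverse of passing from \<open>d\<close> to its \<open>B\<close>-component. An
  element \<open>(- (\<phi> c *\<^sub>C 1), c)\<close> annihilates \<open>A\<close> in the
  \<open>\<phi>\<close>-Lau product, which motivates the first coordinate.\<close>

definition lau_lift ::
    "('b \<Rightarrow> complex) \<Rightarrow> ('b \<Rightarrow> 'b) \<Rightarrow> 'a \<times> 'b \<Rightarrow> 'a::{complex_banach_algebra, monoid_mult} \<times> 'b"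
  where "lau_lift \<phi> D p = (- (\<phi> (D (snd p)) *\<^sub>C 1), D (snd p))"

text \<open>The lift reads only the second coordinate, where each Lau product is the product of
  \<open>B\<close>. Its values annihilate \<open>A\<close>, so the first coordinates agree by
  applying \<open>\<phi>\<close> to the Leibniz rule of \<open>D\<close>.\<close>

lemma lau_lift_in_lau_Der:
  fixes D :: "'b::complex_banach_algebra \<Rightarrow> 'b"
  assumes \<phi>: "multiplicative_functional \<phi>" and D: "D \<in> Der"
  shows "(lau_lift \<phi> D :: 'a::{complex_banach_algebra, monoid_mult} \<times> 'b \<Rightarrow> 'a \<times> 'b)
    \<in> lau_Der \<theta> \<phi> \<phi>"
proof -
  note \<phi>D = multiplicative_functionalD[OF \<phi>]
  have lin: "clinear D" and der: "D (c * x) = D c * x + c * D x" for c x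
    using D by (auto simp: Der_def)
  have "clinear (lau_lift \<phi> D :: 'a \<times> 'b \<Rightarrow> 'a \<times> 'b)"
    unfolding clinear_iff lau_lift_def
    by (simp add: clinearD[OF lin] \<phi>D scaleC_prod_def scaleC_add_left
        flip: scaleC_minus_left) (simp add: scaleC_scaleC)
  moreover have "lau_lift \<phi> D (lau_times \<theta> p q)
      = lau_times \<phi> (lau_lift \<phi> D p) q + lau_times \<phi> p (lau_lift \<phi> D q)" for p q :: "'a \<times> 'b"
    by (cases p; cases q)
      (simp add: lau_lift_def der \<phi>D scaleC_add_left scaleC_scaleC mult_scaleC_left
        mult_scaleC_right scaleC_minus_right mult.commute)
  ultimately show ?thesis unfolding lau_Der_def by blast
qed

lemma lau_Der_J_form:
  fixes d :: "'a::{complex_banach_algebra, monoid_mult} \<times> 'b::complex_banach_algebra \<Rightarrow> 'a \<times> 'b"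
  assumes ss: "semisimple TYPE('b)"
    and \<theta>: "multiplicative_functional \<theta>" and \<phi>: "multiplicative_functional \<phi>"
    and ne: "\<theta> \<noteq> \<phi>" and d: "d \<in> lau_Der_J \<theta> \<phi> \<phi>"
  shows "(\<lambda>b. snd (d (0, b))) \<in> Der" "d = lau_lift \<phi> (\<lambda>b. snd (d (0, b)))"
proof -
  define d1 where "d1 a = fst (d (a, 0))" for a
  define d2 where "d2 b = fst (d (0, b))" for b
  define d3 where "d3 a = snd (d (a, 0))" for a
  define d4 where "d4 b = snd (d (0, b))" for b
  have lin: "clinear d" and jord: "d (lau_times \<theta> p p) = lau_times \<phi> (d p) p + lau_times \<phi> p (d p)"
    for p
    using d unfolding lau_Der_J_def by blast+
  note \<theta>D = multiplicative_functionalD[OF \<theta>] and \<phi>D = multiplicative_functionalD[OF \<phi>]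
  have d_eq: "d (a, b) = (d1 a + d2 b, d3 a + d4 b)" for a b
    using clinearD(1)[OF lin, of "(a, 0)" "(0, b)"]
    by (simp add: d1_def d2_def d3_def d4_def prod_eq_iff)
  have add: "d1 (a + x) = d1 a + d1 x" "d3 (a + x) = d3 a + d3 x"
    "d2 (b + y) = d2 b + d2 y" "d4 (b + y) = d4 b + d4 y" for a x b y
    using clinearD(1)[OF lin, of "(a, 0)" "(x, 0)"] clinearD(1)[OF lin, of "(0, b)" "(0, y)"]
    by (simp_all add: d1_def d2_def d3_def d4_def)
  have scale: "d1 (c *\<^sub>C a) = c *\<^sub>C d1 a" "d4 (c *\<^sub>C b) = c *\<^sub>C d4 b" for c a b
    using clinearD(2)[OF lin, of c "(a, 0)"] clinearD(2)[OF lin, of c "(0, b)"]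
    by (simp_all add: d1_def d4_def scaleC_prod_def scaleC_zero)
  have zero: "d1 0 = 0" "d2 0 = 0" "d3 0 = 0" "d4 0 = 0"
    using add(1)[of 0 0] add(2)[of 0 0] add(3)[of 0 0] add(4)[of 0 0] by simp_all
  have double: "x = 0" if "x + x = 0" for x :: "'c::real_vector"
    using that by (simp flip: scaleR_2)
  have cancel: "x = y" if "x + x = y + y" for x y :: "'c::real_vector"
    using double[of "x - y"] that by (simp add: algebra_simps)

  \<comment> \<open>Products with \<open>(a, 0)\<close> have second coordinate 0. Comparing the
    squares of \<open>1 + a\<close>, \<open>1\<close> and \<open>a\<close> isolates
    \<open>d3 a + d3 a\<close>.\<close>
  have "d3 (a * a) = 0" for a
    using jord[of "(a, 0)"] by (simp add: d_eq zero \<theta>D \<phi>D scaleC_zero)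
  from this[of "1 + a" for a] this[of 1] this have "d3 a + d3 a = 0" for a
    by (simp add: distrib_left distrib_right add)
  then have d3: "d3 a = 0" for a by (rule double)
  have d1_sq: "d1 (a * a) = d1 a * a + a * d1 a" for a
    using jord[of "(a, 0)"] by (simp add: d_eq zero d3 \<theta>D \<phi>D scaleC_zero)
  from d1_sq[of 1] have d1_one: "d1 1 = 0" by simp
  have d2_sq: "d2 (b * b) = \<phi> b *\<^sub>C d2 b + \<phi> b *\<^sub>C d2 b"
    and d4_sq: "d4 (b * b) = d4 b * b + b * d4 b" for b
    using jord[of "(0, b)"] by (simp_all add: d_eq zero \<theta>D \<phi>D scaleC_zero)
  have d4_Der: "d4 \<in> Der"
    by (rule semisimple_jordan_derivation_in_Der[OF ss _ d4_sq])
      (simp add: clinear_iff add scale)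
  then show "(\<lambda>b. snd (d (0, b))) \<in> Der" unfolding d4_def .

  \<comment> \<open>The first coordinate of the Jordan identity at \<open>(a, b)\<close>, with the
    pure parts \<open>d1_sq\<close> and \<open>d2_sq\<close> cancelled.\<close>
  have mixed: "\<theta> b *\<^sub>C d1 a + \<theta> b *\<^sub>C d1 a
      = a * d2 b + d2 b * a + (\<phi> b *\<^sub>C d1 a + \<phi> b *\<^sub>C d1 a)
        + (\<phi> (d4 b) *\<^sub>C a + \<phi> (d4 b) *\<^sub>C a)" for a b
    using jord[of "(a, b)"]
    by (simp add: d_eq zero d3 add scale d1_sq d2_sq scaleC_add_right algebra_simps)
  have d2: "d2 b = - (\<phi> (d4 b) *\<^sub>C 1)" for b
  proof -
    have "(d2 b + \<phi> (d4 b) *\<^sub>C 1) + (d2 b + \<phi> (d4 b) *\<^sub>C 1) = 0"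
      using mixed[of b 1] by (simp add: d1_one scaleC_zero algebra_simps)
    then show ?thesis using double by (simp add: eq_neg_iff_add_eq_0)
  qed
  obtain b\<^sub>0 where b0: "\<theta> b\<^sub>0 \<noteq> \<phi> b\<^sub>0" using ne by blast
  have d1: "d1 a = 0" for a
  proof -
    \<comment> \<open>Since \<open>d2 b\<^sub>0\<close> is a multiple of 1, its two products with
      \<open>a\<close> cancel the terms \<open>\<phi> (d4 b\<^sub>0) *\<^sub>C a\<close> in
      \<open>mixed\<close>.\<close>
    have "\<theta> b\<^sub>0 *\<^sub>C d1 a = \<phi> b\<^sub>0 *\<^sub>C d1 a"
      by (rule cancel) (use mixed[of b\<^sub>0 a] in \<open>simp add: d2 mult_scaleC_left mult_scaleC_right\<close>)
    then have "(\<theta> b\<^sub>0 + - \<phi> b\<^sub>0) *\<^sub>C d1 a = 0"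
      unfolding scaleC_add_left scaleC_minus_left by simp
    then show ?thesis by (rule scaleC_eq_0D) (use b0 in simp)
  qed
  have "d p = lau_lift \<phi> d4 p" for p
    by (cases p) (simp add: d_eq d1 d2 d3 lau_lift_def)
  then show "d = lau_lift \<phi> (\<lambda>b. snd (d (0, b)))"
    unfolding d4_def by blast
qed

theorem corollary2p5:
  fixes \<theta> \<phi> :: "'b::complex_banach_algebra \<Rightarrow> complex"
  assumes "semisimple TYPE('b)"
    and "multiplicative_functional \<theta>" and "\<theta> \<noteq> (\<lambda>_. 0)"
    and "multiplicative_functional \<phi>" and "\<phi> \<noteq> (\<lambda>_. 0)"
    and "\<theta> \<noteq> \<phi>"
  shows "(lau_Der_J \<theta> \<phi> \<phi> :: ('a::{complex_banach_algebra, monoid_mult} \<times> 'b \<Rightarrow> 'a \<times> 'b) set)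
           = lau_Der \<theta> \<phi> \<phi> \<and>
         bij_betw (\<lambda>d b. snd (d (0, b)))
           (lau_Der \<theta> \<phi> \<phi> :: ('a \<times> 'b \<Rightarrow> 'a \<times> 'b) set) Der"
proof
  let ?J = "lau_Der_J \<theta> \<phi> \<phi> :: ('a \<times> 'b \<Rightarrow> 'a \<times> 'b) set"
  let ?D = "lau_Der \<theta> \<phi> \<phi> :: ('a \<times> 'b \<Rightarrow> 'a \<times> 'b) set"
  note form = lau_Der_J_form[OF assms(1,2,4,6)]
  show eq: "?J = ?D"
  proof
    \<comment> \<open>A Jordan map is the lift of its \<open>B\<close>-component, a derivation, and
      such lifts satisfy the full identity.\<close>
    show "?J \<subseteq> ?D"
      using form lau_lift_in_lau_Der[OF assms(4)] by (metis subsetI)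
    show "?D \<subseteq> ?J"
      by (auto simp: lau_Der_J_def lau_Der_def)
  qed
  show "bij_betw (\<lambda>d b. snd (d (0, b))) ?D Der"
  proof (rule bij_betw_byWitness[where f' = "lau_lift \<phi>"])
    show "\<forall>d\<in>?D. lau_lift \<phi> (\<lambda>b. snd (d (0, b))) = d"
      unfolding eq[symmetric] using form(2)[symmetric] by blast
    show "\<forall>D\<in>Der. (\<lambda>b. snd ((lau_lift \<phi> D :: 'a \<times> 'b \<Rightarrow> 'a \<times> 'b) (0, b))) = D"
      by (simp add: lau_lift_def)
    show "(\<lambda>d b. snd (d (0, b))) ` ?D \<subseteq> Der"
      using form(1) by (auto simp flip: eq)
    show "lau_lift \<phi> ` Der \<subseteq> ?D"
      using lau_lift_in_lau_Der[OF assms(4)] by blast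
  qed
qed

end
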